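(* Let $m$ be a positive integer, let $h$ be a positive divisor of $m$ with $h<m$, and suppose $m/h$ is odd. Put $q=2^m$, $D_1=\{x\in\mathbb{F}_q^*:\mathrm{Tr}(x)=1\}$ and $$\mathcal{C}_{D_1}=\left\{\left(\mathrm{Tr}(x d^{2^h+1})\right)_{d\in D_1}: x\in\mathbb{F}_q\right\}.$$ Then $\mathcal{C}_{D_1}$ is a $[2^{m-1},\,m]$ binary linear code whose weight distribution is as follows: there is exactly $1$ codeword of weight $0$; the number of codewords of weight $2^{m-2}$ is $2^m-1-2^{m-h}$; the number of codewords of weight $2^{m-2}-2^{\frac{m+h-4}{2}}$ is $2^{m-h-1}-2^{\frac{m-h-2}{2}}$; the number of codewords of weight $2^{m-2}+2^{\frac{m+h-4}{2}}$ is $2^{m-h-1}+2^{\frac{m-h-2}{2}}$; and there are no codewords of any other weight.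
   Context: $\mathbb{F}_q$ is the finite field with $q=2^m$ elements, $\mathbb{F}_q^*$ its multiplicative group, and $\mathrm{Tr}:\mathbb{F}_q\to\mathbb{F}_2$ is the absolute trace. An $[n,k]$ binary linear code is a $k$-dimensional $\mathbb{F}_2$-subspace of $\mathbb{F}_2^n$; the (Hamming) weight of a codeword is its number of nonzero coordinates; the weight distribution records, for each $i$, the number of codewords of weight $i$. *)

theory Defs
  imports
    "HOL-Number_Theory.Number_Theory"
    "HOL-Library.Z2"
    "HOL-Library.Function_Algebras"
    "HOL-Library.Cardinality"
begin

text \<open>
  The field with two elements is \<^typ>\<open>bit\<close>. The absolute trace takes values in it: \<open>bit_embed\<close> is
  the inclusion of the prime field into a field of characteristic two, and \<open>abs_trace m x\<close> is the
  preimage of \<open>x + x\<^sup>2 + x\<^sup>4 + \<dots>\<close> (\<open>m\<close> terms). Its existence and uniqueness for a field with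
  \<open>2 ^ m\<close> elements is the lemma \<open>bit_embed_abs_trace\<close> below.
\<close>

definition bit_embed :: "bit \<Rightarrow> 'a::zero_neq_one" where
  "bit_embed b = of_bool (b = 1)"

definition abs_trace :: "nat \<Rightarrow> 'a::finite_field \<Rightarrow> bit" where
  "abs_trace m x = (THE b. bit_embed b = (\<Sum>i<m. x ^ (2 ^ i)))"

lemma bit_embed_inject: "bit_embed a = bit_embed b \<longleftrightarrow> a = b"
  by (cases a; cases b) (auto simp: bit_embed_def)

lemma CHAR_eq_2:
  assumes "CARD('a::finite_field) = 2 ^ m"
  shows "CHAR('a) = 2"
proof -
  have "CHAR('a) dvd 2 ^ m"
    using CHAR_dvd_CARD[where ?'a = 'a] assms by simp
  moreover have "prime CHAR('a)"
    by (rule prime_CHAR_semidom) (simp add: CHAR_pos)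
  ultimately show ?thesis
    using prime_dvd_power primes_dvd_imp_eq two_is_prime_nat by blast
qed

lemma bit_embed_abs_trace:
  fixes x :: "'a::finite_field"
  assumes "CARD('a) = 2 ^ m"
  shows "bit_embed (abs_trace m x) = (\<Sum>i<m. x ^ (2 ^ i))"
proof -
  let ?s = "\<Sum>i<m. x ^ (2 ^ i)"
  have ch: "CHAR('a) = 2"
    using assms by (rule CHAR_eq_2)
  have fd: "?s ^ 2 = (\<Sum>i<m. (x ^ (2 ^ i)) ^ 2)"
    using freshmans_dream_sum[where ?'a = 'a and f = "\<lambda>i. x ^ (2 ^ i)" and A = "{..<m}"] ch
    by simp
  also have "\<dots> = (\<Sum>i<m. x ^ (2 ^ Suc i))"
    by (simp add: power_mult[symmetric] mult.commute)
  also have "\<dots> + x = ?s + x ^ (2 ^ m)"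
    using sum.lessThan_Suc_shift[of "\<lambda>i. x ^ (2 ^ i)" m]
    by (simp add: add.commute)
  moreover have "x ^ (2 ^ m) = x"
    using finite_field_power_card_eq_same[of x] assms by simp
  ultimately have "?s ^ 2 = ?s"
    by simp
  hence "?s = 0 \<or> ?s = 1"
    by (simp add: power2_eq_square)
  hence "?s = bit_embed 0 \<or> ?s = bit_embed 1"
    by (simp add: bit_embed_def)
  hence "\<exists>!b. bit_embed b = ?s"
    by (metis bit_embed_inject)
  thus ?thesis
    unfolding abs_trace_def by (rule theI')
qed

text \<open>
  Vectors with coordinates indexed by a finite set \<open>I\<close> are functions vanishing outside \<open>I\<close>.
\<close>

definition bit_scale :: "bit \<Rightarrow> ('i \<Rightarrow> bit) \<Rightarrow> 'i \<Rightarrow> bit" where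
  "bit_scale a v = (\<lambda>i. a * v i)"

global_interpretation bit_fun: vector_space "bit_scale :: bit \<Rightarrow> ('i \<Rightarrow> bit) \<Rightarrow> 'i \<Rightarrow> bit"
  by unfold_locales (auto simp: bit_scale_def fun_eq_iff distrib_left distrib_right mult.assoc)

definition coord_space :: "'i set \<Rightarrow> ('i \<Rightarrow> bit) set" where
  "coord_space I = {v. \<forall>i. i \<notin> I \<longrightarrow> v i = 0}"

definition binary_linear_code :: "'i set \<Rightarrow> nat \<Rightarrow> nat \<Rightarrow> ('i \<Rightarrow> bit) set \<Rightarrow> bool" where
  "binary_linear_code I n k C \<longleftrightarrow>
     finite I \<and> card I = n \<and> C \<subseteq> coord_space I \<and> bit_fun.subspace C \<and> bit_fun.dim C = k"

definition hamming_weight :: "'i set \<Rightarrow> ('i \<Rightarrow> bit) \<Rightarrow> nat" where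
  "hamming_weight I c = card {i \<in> I. c i \<noteq> 0}"

definition weight_count :: "'i set \<Rightarrow> ('i \<Rightarrow> bit) set \<Rightarrow> nat \<Rightarrow> nat" where
  "weight_count I C w = card {c \<in> C. hamming_weight I c = w}"

definition trace_one_set :: "nat \<Rightarrow> 'a::finite_field set" where
  "trace_one_set m = {x. x \<noteq> 0 \<and> abs_trace m x = 1}"

definition trace_code :: "nat \<Rightarrow> nat \<Rightarrow> 'a::finite_field set \<Rightarrow> ('a \<Rightarrow> bit) set" where
  "trace_code m h D =
     range (\<lambda>x d. if d \<in> D then abs_trace m (x * d ^ (2 ^ h + 1)) else 0)"

end

theory Submission
  imports Defs "HOL-Computational_Algebra.Polynomial"
begin

text \<open>
  Let \<open>Q = 2 ^ h\<close>, \<open>q = 2 ^ m\<close> and \<open>\<chi> x = (- 1) ^ Tr x\<close>. As \<open>m / h\<close> is odd, \<open>x \<mapsto> x ^ (Q + 1)\<close> permutes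
  the field, so each nonzero codeword has its parameter of the form \<open>inverse b ^ (Q + 1)\<close> with \<open>b \<noteq> 0\<close>.
  Substituting \<open>d = b * y\<close> shows that four times its weight is \<open>q + S b\<close>, where \<open>S b\<close> is the sum of
  \<open>\<chi> (x ^ (Q + 1) + b * x)\<close> over all \<open>x\<close>. The polar form of the quadratic form \<open>Tr (x ^ (Q + 1))\<close> has
  the subfield \<open>K\<close> of order \<open>Q\<close> as its radical, so \<open>S b ^ 2\<close> is \<open>q\<close> times the sum of \<open>\<chi> ((1 + b) * u)\<close>
  over \<open>u \<in> K\<close>, which is \<open>0\<close> or \<open>q * Q\<close>. The sums of \<open>S b\<close> and of \<open>S b ^ 2\<close> over all \<open>b\<close> are \<open>q\<close> and
  \<open>q ^ 2\<close>; they determine how often \<open>S\<close> takes each of its three values.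
\<close>

section \<open>Root counts, cancelling sums and the size of binary spans\<close>

lemma card_roots_sum_powers:
  fixes n r :: nat
  assumes "1 < n" "0 < r"
  shows "card {x :: 'a::idom. (\<Sum>i<r. x ^ (n ^ i)) = 0} \<le> n ^ (r - 1)"
proof -
  define p :: "'a poly" where "p = (\<Sum>i<r. monom 1 (n ^ i))"
  \<comment> \<open>As \<open>1 < n\<close>, only \<open>i = 0\<close> contributes in degree 1; this
    coefficient shows that the trace-type polynomial is not zero.\<close>
  have "coeff p 1 = (\<Sum>i<r. if i = 0 then 1 else 0)"
    unfolding p_def coeff_sum coeff_monom
    using assms by (intro sum.cong) auto
  also have "\<dots> = 1"
    using assms by simp
  finally have "p \<noteq> 0"
    by auto
  have "degree p \<le> n ^ (r - 1)"
    unfolding p_def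
  proof (rule degree_sum_le)
    fix i assume "i \<in> {..<r}"
    hence "n ^ i \<le> n ^ (r - 1)"
      using assms by (intro power_increasing) auto
    thus "degree (monom (1::'a) (n ^ i)) \<le> n ^ (r - 1)"
      using degree_monom_le order.trans by blast
  qed simp
  moreover have "{x. (\<Sum>i<r. x ^ (n ^ i)) = 0} = {x. poly p x = 0}"
    by (simp add: p_def poly_sum poly_monom)
  ultimately show ?thesis
    using card_poly_roots_bound[OF \<open>p \<noteq> 0\<close>] by simp
qed

lemma card_power_fixed_points_le:
  assumes "1 < n"
  shows "card {x :: 'a::idom. x ^ n = x} \<le> n"
proof -
  define p :: "'a poly" where "p = monom 1 n - monom 1 1"
  have "coeff p n = 1"
    using assms by (simp add: p_def)
  hence "p \<noteq> 0"
    by auto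
  have "degree p \<le> n"
    unfolding p_def using assms
    by (intro degree_diff_le) (auto intro: order.trans[OF degree_monom_le])
  moreover have "{x. x ^ n = x} = {x. poly p x = 0}"
    by (simp add: p_def poly_monom)
  ultimately show ?thesis
    using card_poly_roots_bound[OF \<open>p \<noteq> 0\<close>] by simp
qed

text \<open>Translation by \<open>g\<close> permutes the finite set \<open>A\<close>, so the sum
  equals its own negative.\<close>

lemma sum_translate_negating_eq_0:
  fixes f :: "'a::group_add \<Rightarrow> int"
  assumes "finite A" "\<And>x. x \<in> A \<Longrightarrow> x + g \<in> A" "\<And>x. x \<in> A \<Longrightarrow> f (x + g) = - f x"
  shows "sum f A = 0"
proof -
  have inj: "inj_on (\<lambda>x. x + g) A"
    by (auto intro: inj_onI)
  have "(\<lambda>x. x + g) ` A = A"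
    using assms inj by (intro endo_inj_surj) auto
  hence "sum f A = (\<Sum>x\<in>A. f (x + g))"
    using sum.reindex[OF inj, of f] by simp
  also have "\<dots> = - sum f A"
    using assms by (simp add: sum_negf)
  finally show ?thesis
    by simp
qed

text \<open>Subtracting one preimage \<open>z\<close> embeds the fibre over \<open>f z\<close> into
  the kernel, and the fibres over the range partition the domain.\<close>

lemma card_le_card_range_mult_kernel:
  fixes f :: "'a::{finite,ab_group_add} \<Rightarrow> 'b::ab_group_add"
  assumes "\<And>x y. f (x - y) = f x - f y"
  shows "CARD('a) \<le> card (range f) * card {x. f x = 0}"
proof -
  have fibre: "card {x. f x = y} \<le> card {x. f x = 0}" if "y \<in> range f" for y
  proof -
    obtain z where "y = f z"
      using \<open>y \<in> range f\<close> by auto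
    thus ?thesis
      using assms by (intro card_inj_on_le[of "\<lambda>x. x - z"]) (auto intro: inj_onI)
  qed
  have "CARD('a) = (\<Sum>y\<in>range f. card {x. f x = y})"
    using sum.image_gen[of "UNIV :: 'a set" "\<lambda>_. 1 :: nat" f] by simp
  also have "\<dots> \<le> card (range f) * card {x. f x = 0}"
    using sum_bounded_above[of "range f" "\<lambda>y. card {x. f x = y}", OF fibre] by simp
  finally show ?thesis .
qed

text \<open>With scalars only 0 and 1, a vector outside the span adds one disjoint translate and so
  doubles the span.\<close>

lemma card_span_independent_bit:
  assumes "finite B" "bit_fun.independent B"
  shows "card (bit_fun.span B) = 2 ^ card B"
  using assms
proof (induction B rule: finite_induct)
  case empty
  thus ?case by simp
next
  case (insert b B)
  have ind: "b \<notin> bit_fun.span B" "bit_fun.independent B"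
    using insert.prems insert.hyps by (auto simp: bit_fun.independent_insert)
  have two: "(\<exists>k::bit. P k) \<longleftrightarrow> P 0 \<or> P 1" for P
    by (metis bit_not_one_iff)
  have eq: "bit_fun.span (insert b B) = bit_fun.span B \<union> (\<lambda>v. v + b) ` bit_fun.span B"
    unfolding bit_fun.span_insert two bit_fun.scale_zero_left bit_fun.scale_one
    by (auto simp: image_iff) (metis diff_add_cancel)
  have "card (bit_fun.span B) = 2 ^ card B"
    using insert.IH ind by simp
  \<comment> \<open>An infinite set has \<open>card\<close> 0, which is not a power of two.\<close>
  moreover from this have "finite (bit_fun.span B)"
    by (metis card.infinite power_not_zero zero_neq_numeral)
  moreover have "bit_fun.span B \<inter> (\<lambda>v. v + b) ` bit_fun.span B = {}"
    using ind bit_fun.span_diff[of _ B] by (force simp: algebra_simps)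
  moreover have "card ((\<lambda>v. v + b) ` bit_fun.span B) = card (bit_fun.span B)"
    by (intro card_image inj_onI) simp
  ultimately show ?case
    using insert.hyps by (simp add: eq card_Un_disjoint)
qed

text \<open>Reduces the dimension of a code to a count of its codewords.\<close>

lemma bit_fun_dim_eq:
  assumes "bit_fun.subspace C" "card C = 2 ^ k"
  shows "bit_fun.dim C = k"
proof -
  obtain B where B: "B \<subseteq> C" "bit_fun.independent B" "C \<subseteq> bit_fun.span B" "card B = bit_fun.dim C"
    using bit_fun.basis_exists by blast
  have "finite C"
    using assms by (metis card.infinite power_not_zero zero_neq_numeral)
  hence "finite B"
    using B finite_subset by blast
  moreover have "bit_fun.span B = C"
    using B assms by (metis bit_fun.span_subspace)
  ultimately have "(2::nat) ^ card B = 2 ^ k"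
    using card_span_independent_bit[of B] B assms by simp
  thus ?thesis
    using B by simp
qed

section \<open>The additive character of the absolute trace\<close>

text \<open>In characteristic two the canonical additive character takes only the values 1 and -1,
  so it can live in \<open>int\<close>.\<close>

definition add_char :: "nat \<Rightarrow> 'a::finite_field \<Rightarrow> int" where
  "add_char m x = (if abs_trace m x = 0 then 1 else - 1)"

locale char_two_field =
  fixes m :: nat and field_type :: "'a::finite_field itself"
  assumes card_field: "CARD('a) = 2 ^ m"
begin

lemma add_self [simp]: "(x::'a) + x = 0"
  using CHAR_eq_2[OF card_field] uminus_CHAR_2[where ?'a = 'a] by (metis add.right_inverse)

lemma minus_eq_self: "- (x::'a) = x"
  by (simp add: minus_unique)

lemma diff_eq_add: "(x::'a) - y = x + y"
  using minus_eq_self[of y] by (metis diff_conv_add_uminus)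

lemma add_eq_0_iff_eq: "(x::'a) + y = 0 \<longleftrightarrow> x = y"
  by (metis diff_eq_add right_minus_eq)

lemma power_two_power_add: "(x + y :: 'a) ^ (2 ^ n) = x ^ (2 ^ n) + y ^ (2 ^ n)"
  by (rule freshmans_dream') (simp_all add: CHAR_eq_2[OF card_field])

lemma power_two_power_inject: "(x::'a) ^ (2 ^ n) = y ^ (2 ^ n) \<longleftrightarrow> x = y"
  by (metis add_eq_0_iff_eq power_two_power_add power_eq_0_iff)

lemma bij_power_two_power: "bij (\<lambda>x::'a. x ^ (2 ^ n))"
  by (intro finite_UNIV_inj_surj[THEN bijI[rotated]] injI)
    (auto simp: power_two_power_inject intro: injI)

lemma m_pos: "0 < m"
proof (rule ccontr)
  assume "\<not> 0 < m"
  hence "CARD('a) = 1"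
    using card_field by simp
  hence "(0::'a) = 1"
    by (metis card_1_singletonE UNIV_I singletonD)
  thus False by simp
qed

lemma bit_embed_add: "(bit_embed (a + b) :: 'a) = bit_embed a + bit_embed b"
  by (cases a; cases b) (simp_all add: bit_embed_def)

lemma abs_trace_add: "abs_trace m (x + y :: 'a) = abs_trace m x + abs_trace m y"
proof -
  have "(bit_embed (abs_trace m (x + y)) :: 'a) = bit_embed (abs_trace m x + abs_trace m y)"
    by (simp only: bit_embed_add bit_embed_abs_trace[OF card_field] power_two_power_add sum.distrib)
  thus ?thesis
    by (simp only: bit_embed_inject)
qed

lemma abs_trace_0 [simp]: "abs_trace m (0::'a) = 0"
  using abs_trace_add[of 0 0] by simp

text \<open>Squaring shifts the terms of the trace cyclically, because
  \<open>x ^ (2 ^ m) = x\<close>.\<close>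

lemma abs_trace_square: "abs_trace m (x ^ 2 :: 'a) = abs_trace m x"
proof -
  have "(\<Sum>i<m. (x ^ 2) ^ (2 ^ i)) + x = (\<Sum>i<m. x ^ (2 ^ Suc i)) + x"
    by (simp flip: power_mult)
  also have "\<dots> = (\<Sum>i<m. x ^ (2 ^ i)) + x ^ (2 ^ m)"
    using sum.lessThan_Suc_shift[of "\<lambda>i. x ^ (2 ^ i)" m] by (simp add: add.commute)
  also have "x ^ (2 ^ m) = x"
    using finite_field_power_card_eq_same[of x] card_field by simp
  finally have "(bit_embed (abs_trace m (x ^ 2)) :: 'a) = bit_embed (abs_trace m x)"
    by (simp add: bit_embed_abs_trace[OF card_field])
  thus ?thesis
    by (simp only: bit_embed_inject)
qed

lemma abs_trace_power_two_power: "abs_trace m (x ^ (2 ^ n) :: 'a) = abs_trace m x"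
  by (induction n) (simp_all add: power_mult abs_trace_square mult.commute[of 2])

text \<open>Otherwise all \<open>2 ^ m\<close> elements would be roots of the trace polynomial,
  whose degree is only \<open>2 ^ (m - 1)\<close>.\<close>

lemma abs_trace_nonzero: "\<exists>x::'a. abs_trace m x \<noteq> 0"
proof (rule ccontr)
  assume "\<not> ?thesis"
  hence "(\<Sum>i<m. (x::'a) ^ (2 ^ i)) = 0" for x
    using bit_embed_abs_trace[OF card_field, of x] by (simp add: bit_embed_def)
  hence "CARD('a) \<le> 2 ^ (m - 1)"
    using card_roots_sum_powers[of 2 m, where ?'a = 'a] m_pos by simp
  thus False
    using m_pos by (simp add: card_field)
qed

lemma add_char_add: "add_char m (x + y :: 'a) = add_char m x * add_char m y"
  by (cases "abs_trace m x"; cases "abs_trace m y") (simp_all add: add_char_def abs_trace_add)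

lemma add_char_0 [simp]: "add_char m (0::'a) = 1"
  by (simp add: add_char_def)

lemma add_char_power_two_power: "add_char m (x ^ (2 ^ n) :: 'a) = add_char m x"
  by (simp add: add_char_def abs_trace_power_two_power)

text \<open>Either every term is 1, or translation by some \<open>g\<close> in \<open>A\<close>
  negates every term.\<close>

lemma sum_add_char_subgroup:
  fixes A :: "'a set"
  assumes "\<And>x y. x \<in> A \<Longrightarrow> y \<in> A \<Longrightarrow> x + y \<in> A"
  shows "(\<Sum>x\<in>A. add_char m (a * x)) \<in> {0, int (card A)}"
proof (cases "\<forall>x\<in>A. add_char m (a * x) = 1")
  case False
  then obtain g where "g \<in> A" "add_char m (a * g) = - 1"
    by (auto simp: add_char_def split: if_splits)
  hence "(\<Sum>x\<in>A. add_char m (a * x)) = 0"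
    using assms by (intro sum_translate_negating_eq_0[of _ g])
      (auto simp: distrib_left add_char_add)
  thus ?thesis by simp
qed simp

lemma sum_add_char: "(\<Sum>x\<in>UNIV. add_char m (a * x :: 'a)) = (if a = 0 then 2 ^ m else 0)"
proof (cases "a = 0")
  case False
  obtain t :: 'a where "abs_trace m t \<noteq> 0"
    using abs_trace_nonzero by blast
  with False have "add_char m (a * (t / a)) = - 1"
    by (simp add: add_char_def)
  with False show ?thesis
    using sum_translate_negating_eq_0[of UNIV "t / a" "\<lambda>x. add_char m (a * x)"]
    by (simp add: distrib_left add_char_add)
qed (simp add: card_field)

lemma sum_add_char_plain: "(\<Sum>x\<in>UNIV. add_char m (x :: 'a)) = 0"
  using sum_add_char[of 1] by simp

lemma card_trace_one_set: "card (trace_one_set m :: 'a set) = 2 ^ (m - 1)"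
proof -
  let ?D = "trace_one_set m :: 'a set"
  have D: "?D = {x. abs_trace m x = 1}"
    by (auto simp: trace_one_set_def)
  \<comment> \<open>The character is 1 minus twice the indicator of trace 1, so its zero sum says
    that half of the field has trace 1.\<close>
  have "(0::int) = (\<Sum>x\<in>UNIV. 1 - 2 * of_bool (abs_trace m (x::'a) = 1))"
    unfolding sum_add_char_plain[symmetric]
    by (intro sum.cong) (auto simp: add_char_def)
  also have "\<dots> = 2 ^ m - 2 * int (card ?D)"
    by (simp add: sum_subtractf card_field D flip: sum_distrib_left)
  finally have "2 * int (card ?D) = 2 * 2 ^ (m - 1)"
    using m_pos by (simp flip: power_Suc)
  hence "int (card ?D) = int (2 ^ (m - 1))"
    by simp
  thus ?thesis
    by (simp only: of_nat_eq_iff)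
qed

end

section \<open>The exponential sum\<close>

locale gold_code = char_two_field m field_type for m and field_type :: "'a::finite_field itself" +
  fixes h :: nat
  assumes h_pos: "0 < h" and h_dvd: "h dvd m" and h_less: "h < m" and odd_quotient: "odd (m div h)"
begin

lemma m_decomp: obtains k where "m = h * (2 * k + 1)" "0 < k"
proof -
  obtain k where "m div h = 2 * k + 1"
    using odd_quotient oddE by blast
  hence "m = h * (2 * k + 1)"
    using h_dvd by (metis dvd_mult_div_cancel)
  thus ?thesis
    using h_less that[of k] by (cases k) auto
qed

lemma one_less_subfield_order: "1 < (2::nat) ^ h"
  using h_pos by (intro one_less_power) auto

section \<open>The subfield of order \<open>2 ^ h\<close> and the bijectivity of the Gold
  power\<close>

definition subfield :: "'a set" where
  "subfield = {x. x ^ (2 ^ h) = x}"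

text \<open>The oddness of \<open>m div h\<close> enters here. If two applications of the
  \<open>2 ^ h\<close>-power map fix \<open>x\<close>, so do \<open>2 * k\<close> of them; one more
  gives \<open>x ^ (2 ^ m) = x\<close>, as \<open>m = h * (2 * k + 1)\<close>, so a single
  application fixes \<open>x\<close> too.\<close>

lemma subfield_iff_double: "x \<in> subfield \<longleftrightarrow> (x ^ (2 ^ h)) ^ (2 ^ h) = x"
proof
  assume *: "(x ^ (2 ^ h)) ^ (2 ^ h) = x"
  obtain k where k: "m = h * (2 * k + 1)"
    using m_decomp by blast
  have "x ^ (2 ^ (h * (2 * j))) = x" for j
  proof (induction j)
    case (Suc j)
    have "h * (2 * Suc j) = h + (h + h * (2 * j))"
      by simp
    hence "x ^ (2 ^ (h * (2 * Suc j))) = ((x ^ (2 ^ h)) ^ (2 ^ h)) ^ (2 ^ (h * (2 * j)))"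
      by (simp only: power_add power_mult)
    thus ?case
      using * Suc by simp
  qed simp
  moreover have "x ^ (2 ^ m) = (x ^ (2 ^ (h * (2 * k)))) ^ (2 ^ h)"
    by (simp only: k distrib_left mult_1_right power_add power_mult)
  moreover have "x ^ (2 ^ m) = x"
    using finite_field_power_card_eq_same[of x] card_field by simp
  ultimately show "x \<in> subfield"
    by (simp add: subfield_def)
qed (simp add: subfield_def)

text \<open>
  The lower bound holds because \<open>x ^ Q - x\<close> lies in the kernel of the relative trace, which has at
  most \<open>2 ^ (m - h)\<close> elements.
\<close>

lemma card_subfield: "card subfield = 2 ^ h"
proof (rule antisym)
  show "card subfield \<le> 2 ^ h"
    unfolding subfield_def using one_less_subfield_order by (rule card_power_fixed_points_le)
next
  define f where "f = (\<lambda>x::'a. x ^ (2 ^ h) - x)"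
  have dvd: "h * (m div h) = m"
    using h_dvd by simp
  have pos: "0 < m div h"
    using odd_quotient by (cases "m div h") auto
  have "range f \<subseteq> {x. (\<Sum>i<m div h. x ^ ((2 ^ h) ^ i)) = 0}"
  proof clarify
    fix x :: 'a
    have "(\<Sum>i<m div h. f x ^ ((2 ^ h) ^ i)) =
        (\<Sum>i<m div h. x ^ ((2 ^ h) ^ Suc i) - x ^ ((2 ^ h) ^ i))"
      by (simp add: f_def diff_eq_add power_two_power_add flip: power_mult power_add)
    also have "\<dots> = x ^ ((2 ^ h) ^ (m div h)) - x"
      using sum_lessThan_telescope[of "\<lambda>i. x ^ ((2 ^ h) ^ i)"] by simp
    also have "\<dots> = 0"
      using finite_field_power_card_eq_same[of x] card_field by (simp add: dvd flip: power_mult)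
    finally show "(\<Sum>i<m div h. f x ^ ((2 ^ h) ^ i)) = 0" .
  qed
  hence "card (range f) \<le> card {x::'a. (\<Sum>i<m div h. x ^ ((2 ^ h) ^ i)) = 0}"
    by (intro card_mono) auto
  also have "\<dots> \<le> (2 ^ h) ^ (m div h - 1)"
    using one_less_subfield_order pos by (rule card_roots_sum_powers)
  also have "\<dots> = 2 ^ (m - h)"
    by (simp add: right_diff_distrib' dvd flip: power_mult)
  finally have range: "card (range f) \<le> 2 ^ (m - h)" .
  have "CARD('a) \<le> card (range f) * card {x. f x = 0}"
    by (rule card_le_card_range_mult_kernel)
      (simp add: f_def diff_eq_add power_two_power_add algebra_simps)
  also have "{x. f x = 0} = subfield"
    by (simp add: f_def subfield_def)
  also have "card (range f) * card subfield \<le> 2 ^ (m - h) * card subfield"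
    using range by simp
  finally have "2 ^ (m - h) * 2 ^ h \<le> 2 ^ (m - h) * card subfield"
    using h_less by (simp add: card_field flip: power_add)
  thus "2 ^ h \<le> card subfield"
    by simp
qed

text \<open>The kernel on units is trivial: if \<open>x ^ (2 ^ h + 1) = 1\<close>, the
  \<open>2 ^ h\<close>-power map inverts \<open>x\<close>, so its double application fixes
  \<open>x\<close>; then \<open>x\<close> lies in the subfield, whence \<open>x ^ 2 = 1\<close> and
  \<open>x = 1\<close>.\<close>

lemma bij_gold_power: "bij (\<lambda>x::'a. x ^ (2 ^ h + 1))"
proof -
  have unit: "x = 1" if "x ^ (2 ^ h + 1) = 1" for x :: 'a
  proof -
    have "x \<noteq> 0"
      using that by auto
    hence "x ^ (2 ^ h) = inverse x"
      using that by (simp add: field_simps)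
    hence "x \<in> subfield"
      by (simp add: subfield_iff_double power_inverse)
    hence "x ^ 2 = 1 ^ 2"
      using that by (simp add: subfield_def power2_eq_square)
    thus ?thesis
      using power_two_power_inject[of x 1 1] by simp
  qed
  have "inj (\<lambda>x::'a. x ^ (2 ^ h + 1))"
  proof (rule injI)
    fix x y :: 'a
    assume eq: "x ^ (2 ^ h + 1) = y ^ (2 ^ h + 1)"
    show "x = y"
    proof (cases "y = 0")
      case True
      with eq show ?thesis by simp
    next
      case False
      hence "y ^ (2 ^ h + 1) \<noteq> 0"
        by simp
      hence "(x / y) ^ (2 ^ h + 1) = 1"
        using eq by (metis power_divide divide_self)
      thus ?thesis
        using unit[of "x / y"] False by simp
    qed
  qed
  thus ?thesis
    by (simp add: bij_def finite_UNIV_inj_surj)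
qed

section \<open>The Walsh transform of the Gold function: its values and their frequencies\<close>

definition gold_sum :: "'a \<Rightarrow> int" where
  "gold_sum b = (\<Sum>x\<in>UNIV. add_char m (x ^ (2 ^ h + 1) + b * x))"

lemma sum_gold_power: "(\<Sum>x\<in>UNIV. add_char m (x ^ (2 ^ h + 1) :: 'a)) = 0"
  using sum.reindex_bij_betw[OF bij_gold_power, of "add_char m"] sum_add_char_plain by simp

lemma gold_sum_0: "gold_sum 0 = 0"
  by (simp only: gold_sum_def mult_zero_left add_0_right sum_gold_power)

text \<open>Pairing \<open>x\<close> with \<open>u + x\<close> in the expanded square leaves, for
  each fixed \<open>u\<close>, the sum of a character that is additive in \<open>x\<close>;
  orthogonality kills it unless \<open>u\<close> is in the subfield.\<close>

lemma gold_sum_square: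
  "gold_sum b ^ 2 = 2 ^ m * (\<Sum>u\<in>subfield. add_char m ((1 + b) * u))"
proof -
  define e :: nat where "e = 2 ^ h + 1"
  define c where "c = (\<lambda>x::'a. add_char m (x ^ e + b * x))"
  have diff: "c x * c (u + x) = c u * add_char m ((u + (u ^ (2 ^ h)) ^ (2 ^ h)) * x ^ (2 ^ h))" for x u
  proof -
    have "x ^ e + b * x + ((u + x) ^ e + b * (u + x)) =
        (u ^ e + b * u) + u * x ^ (2 ^ h) + u ^ (2 ^ h) * x + (x ^ e + x ^ e) + (b * x + b * x)"
      by (simp add: e_def power_two_power_add algebra_simps del: add_self)
    hence "c x * c (u + x) = c u * (add_char m (u * x ^ (2 ^ h)) * add_char m (u ^ (2 ^ h) * x))"
      by (simp add: c_def add.assoc flip: add_char_add)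
    \<comment> \<open>Invariance of the trace under Frobenius turns \<open>x\<close> into
      \<open>x ^ (2 ^ h)\<close>, so both cross terms become multiples of the same quantity.\<close>
    also have "add_char m (u ^ (2 ^ h) * x) = add_char m ((u ^ (2 ^ h)) ^ (2 ^ h) * x ^ (2 ^ h))"
      by (metis add_char_power_two_power power_mult_distrib)
    finally show ?thesis
      by (simp add: distrib_right add_char_add)
  qed
  have inner: "(\<Sum>x\<in>UNIV. add_char m (a * x ^ (2 ^ h) :: 'a)) = (if a = 0 then 2 ^ m else 0)" for a
    using sum.reindex_bij_betw[OF bij_power_two_power, of "\<lambda>x. add_char m (a * x)" h] sum_add_char
    by simp
  have translate: "(\<Sum>y\<in>UNIV. c y) = (\<Sum>u\<in>UNIV. c (u + x))" for x
    by (rule sum.reindex_bij_witness[of _ "\<lambda>u. u + x" "\<lambda>y. y - x"]) auto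
  have "gold_sum b ^ 2 = (\<Sum>x\<in>UNIV. c x * (\<Sum>y\<in>UNIV. c y))"
    by (simp add: gold_sum_def c_def e_def power2_eq_square sum_distrib_right)
  also have "\<dots> = (\<Sum>x\<in>UNIV. \<Sum>u\<in>UNIV. c x * c (u + x))"
    by (intro sum.cong refl) (simp only: translate[symmetric] sum_distrib_left[symmetric])
  also have "\<dots> = (\<Sum>u\<in>UNIV. \<Sum>x\<in>UNIV. c x * c (u + x))"
    by (rule sum.swap)
  also have "\<dots> = (\<Sum>u\<in>UNIV. if u \<in> subfield then 2 ^ m * c u else 0)"
    by (intro sum.cong refl)
      (auto simp: diff inner subfield_iff_double add_eq_0_iff_eq simp flip: sum_distrib_left)
  also have "\<dots> = (\<Sum>u\<in>subfield. 2 ^ m * c u)"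
    by (simp add: sum.If_cases)
  also have "\<dots> = (\<Sum>u\<in>subfield. 2 ^ m * add_char m ((1 + b) * u))"
  proof (intro sum.cong refl arg_cong[of _ _ "\<lambda>z. 2 ^ m * z"])
    fix u assume "u \<in> subfield"
    \<comment> \<open>On the subfield the Gold power is the square, which the trace does not see;
      the quadratic form becomes linear there.\<close>
    hence "u ^ e = u ^ (2 ^ 1)"
      by (simp add: subfield_def e_def power2_eq_square)
    thus "c u = add_char m ((1 + b) * u)"
      using add_char_power_two_power[of u 1] by (simp add: c_def distrib_right add_char_add)
  qed
  finally show ?thesis
    by (simp add: sum_distrib_left)
qed

text \<open>The integer \<open>n\<close>, half of \<open>m - h\<close>, replaces the halved
  exponents; it is \<open>h * k\<close> when \<open>m = h * (2 * k + 1)\<close>.\<close>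

lemma half_exponent: obtains n where "m = 2 * n + h" "0 < n"
proof -
  obtain k where "m = h * (2 * k + 1)" "0 < k"
    by (rule m_decomp)
  thus ?thesis
    using that[of "h * k"] h_pos by simp
qed

text \<open>The square is 0 or \<open>2 ^ m * 2 ^ h\<close>, and \<open>m + h = 2 * (n + h)\<close>
  makes the latter a perfect square.\<close>

lemma gold_sum_values:
  assumes "m = 2 * n + h"
  shows "gold_sum b \<in> {0, 2 ^ (n + h), - (2 ^ (n + h))}"
proof -
  have "(\<Sum>u\<in>subfield. add_char m ((1 + b) * u)) \<in> {0, int (card subfield)}"
    by (rule sum_add_char_subgroup) (simp add: subfield_def power_two_power_add)
  moreover have "(2::int) ^ m * 2 ^ h = (2 ^ (n + h)) ^ 2"
    by (simp add: assms flip: power_add power_mult)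
  ultimately have "gold_sum b ^ 2 = 0 \<or> gold_sum b ^ 2 = (2 ^ (n + h)) ^ 2"
    by (auto simp: gold_sum_square card_subfield)
  thus ?thesis
    by (auto simp: power2_eq_iff)
qed

text \<open>When \<open>b\<close> is summed first, orthogonality leaves only
  \<open>x = 0\<close>.\<close>

lemma sum_gold_sum: "(\<Sum>b\<in>UNIV. gold_sum b) = 2 ^ m"
proof -
  have "(\<Sum>b\<in>UNIV. gold_sum b) =
      (\<Sum>x\<in>UNIV. \<Sum>b\<in>UNIV. add_char m (x ^ (2 ^ h + 1) + b * x :: 'a))"
    unfolding gold_sum_def by (rule sum.swap)
  also have "\<dots> = (\<Sum>x\<in>UNIV. \<Sum>b\<in>UNIV. add_char m (x ^ (2 ^ h + 1)) * add_char m (x * b :: 'a))"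
    by (intro sum.cong refl) (simp only: add_char_add mult.commute)
  also have "\<dots> = (\<Sum>x\<in>UNIV. if x = (0::'a) then 2 ^ m else 0)"
    by (intro sum.cong refl) (auto simp: sum_add_char simp flip: sum_distrib_left)
  finally show ?thesis
    by simp
qed

text \<open>After \<open>gold_sum_square\<close>, summation over \<open>b\<close> keeps only
  \<open>u = 0\<close>.\<close>

lemma sum_gold_sum_square: "(\<Sum>b\<in>UNIV. gold_sum b ^ 2) = 2 ^ m * 2 ^ m"
proof -
  have "(\<Sum>b\<in>UNIV. gold_sum b ^ 2) =
      2 ^ m * (\<Sum>b\<in>UNIV. \<Sum>u\<in>subfield. add_char m ((1 + b) * u))"
    by (simp only: gold_sum_square sum_distrib_left[symmetric])
  also have "(\<Sum>b\<in>UNIV. \<Sum>u\<in>subfield. add_char m ((1 + b) * u)) =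
      (\<Sum>u\<in>subfield. \<Sum>b\<in>UNIV. add_char m ((1 + b) * u))"
    by (rule sum.swap)
  also have "\<dots> = (\<Sum>u\<in>subfield. if u = 0 then 2 ^ m else 0)"
  proof (intro sum.cong refl)
    fix u :: 'a
    show "(\<Sum>b\<in>UNIV. add_char m ((1 + b) * u)) = (if u = 0 then 2 ^ m else 0)"
      by (simp add: distrib_left add_char_add mult.commute[of _ u] sum_add_char card_field
          flip: sum_distrib_left)
  qed
  finally show ?thesis
    by (simp add: subfield_def)
qed

text \<open>The first two moments, divided by \<open>s\<close> and \<open>s ^ 2\<close>, give the
  difference \<open>2 ^ n\<close> and the sum \<open>2 ^ (2 * n)\<close> of the counts of the two
  nonzero values. The third count omits \<open>b = 0\<close>, which will stand for the zero
  codeword.\<close>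

lemma card_gold_sum:
  assumes "m = 2 * n + h" "0 < n"
  shows "card {b. gold_sum b = 2 ^ (n + h)} = 2 ^ (2 * n - 1) + 2 ^ (n - 1)"
    and "card {b. gold_sum b = - (2 ^ (n + h))} = 2 ^ (2 * n - 1) - 2 ^ (n - 1)"
    and "card {b. b \<noteq> 0 \<and> gold_sum b = 0} = 2 ^ m - 1 - 2 ^ (m - h)"
proof -
  define s :: int where "s = 2 ^ (n + h)"
  define P N Z where "P = {b. gold_sum b = s}" and "N = {b. gold_sum b = - s}"
    and "Z = {b. gold_sum b = 0}"
  have "0 < s"
    by (simp add: s_def)
  have val: "gold_sum b = 0 \<or> gold_sum b = s \<or> gold_sum b = - s" for b
    using gold_sum_values[OF assms(1), of b] by (auto simp: s_def)
  have "gold_sum b = s * of_bool (b \<in> P) - s * of_bool (b \<in> N)" for b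
    using val[of b] \<open>0 < s\<close> by (auto simp: P_def N_def)
  hence "(\<Sum>b\<in>UNIV. gold_sum b) = s * int (card P) - s * int (card N)"
    by (simp add: sum_subtractf flip: sum_distrib_left)
  moreover have "(2::int) ^ m = s * 2 ^ n"
    by (simp add: s_def assms mult_2 add_ac flip: power_add)
  ultimately have "s * (int (card P) - int (card N)) = s * 2 ^ n"
    unfolding right_diff_distrib sum_gold_sum by linarith
  hence minus: "int (card P) - int (card N) = 2 ^ n"
    using \<open>0 < s\<close> by simp
  have "gold_sum b ^ 2 = s ^ 2 * of_bool (b \<in> P) + s ^ 2 * of_bool (b \<in> N)" for b
    using val[of b] \<open>0 < s\<close> by (auto simp: P_def N_def)
  hence "(\<Sum>b\<in>UNIV. gold_sum b ^ 2) = s ^ 2 * int (card P) + s ^ 2 * int (card N)"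
    by (simp add: sum.distrib flip: sum_distrib_left)
  moreover have "m + m = (n + h) * 2 + 2 * n"
    using assms by simp
  hence "(2::int) ^ m * 2 ^ m = s ^ 2 * 2 ^ (2 * n)"
    by (simp only: s_def flip: power_add power_mult)
  ultimately have "s ^ 2 * (int (card P) + int (card N)) = s ^ 2 * 2 ^ (2 * n)"
    unfolding distrib_left sum_gold_sum_square by linarith
  hence plus: "int (card P) + int (card N) = 2 ^ (2 * n)"
    using \<open>0 < s\<close> by simp
  have n: "(2::int) ^ n = 2 * 2 ^ (n - 1)" "(2::int) ^ (2 * n) = 2 * 2 ^ (2 * n - 1)"
    using assms by (simp_all flip: power_Suc)
  \<comment> \<open>This keeps the difference in \<open>card N\<close> from being truncated in
    \<open>nat\<close>.\<close>
  have le: "(2::nat) ^ (n - 1) \<le> 2 ^ (2 * n - 1)"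
    by (intro power_increasing) auto
  have "int (card P) = int (2 ^ (2 * n - 1) + 2 ^ (n - 1))"
    using plus minus n by simp
  hence P: "card P = 2 ^ (2 * n - 1) + 2 ^ (n - 1)"
    by (simp only: of_nat_eq_iff)
  have "int (card N) = int (2 ^ (2 * n - 1) - 2 ^ (n - 1))"
    using plus minus n le by (simp add: of_nat_diff)
  hence N: "card N = 2 ^ (2 * n - 1) - 2 ^ (n - 1)"
    by (simp only: of_nat_eq_iff)
  have "card (Z \<union> (P \<union> N)) = card Z + (card P + card N)"
    using \<open>0 < s\<close>
    by (subst card_Un_disjoint, simp, simp, force simp: Z_def P_def N_def)+ simp
  moreover have "Z \<union> (P \<union> N) = UNIV"
    using val by (auto simp: Z_def P_def N_def)
  ultimately have "CARD('a) = card Z + (card P + card N)"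
    by simp
  moreover have "int (card P + card N) = int (2 ^ (m - h))"
    using plus assms by simp
  hence "card P + card N = 2 ^ (m - h)"
    by (simp only: of_nat_eq_iff)
  ultimately have "card Z = 2 ^ m - 2 ^ (m - h)"
    unfolding card_field by linarith
  moreover have "{b. b \<noteq> 0 \<and> gold_sum b = 0} = Z - {0}"
    by (auto simp: Z_def)
  moreover have "0 \<in> Z"
    by (simp add: Z_def gold_sum_0)
  ultimately show "card {b. b \<noteq> 0 \<and> gold_sum b = 0} = 2 ^ m - 1 - 2 ^ (m - h)"
    by simp
  show "card {b. gold_sum b = 2 ^ (n + h)} = 2 ^ (2 * n - 1) + 2 ^ (n - 1)"
    and "card {b. gold_sum b = - (2 ^ (n + h))} = 2 ^ (2 * n - 1) - 2 ^ (n - 1)"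
    using P N by (simp_all add: P_def N_def s_def)
qed

section \<open>The weight distribution\<close>

abbreviation D :: "'a set" where
  "D \<equiv> trace_one_set m"

definition codeword :: "'a \<Rightarrow> 'a \<Rightarrow> bit" where
  "codeword x d = (if d \<in> D then abs_trace m (x * d ^ (2 ^ h + 1)) else 0)"

lemma trace_code_eq: "trace_code m h D = range codeword"
  unfolding trace_code_def codeword_def[abs_def] ..

lemma codeword_add: "codeword (x + y) = codeword x + codeword y"
  by (simp add: codeword_def fun_eq_iff distrib_right abs_trace_add)

lemma codeword_0: "codeword 0 = 0"
  by (simp add: codeword_def fun_eq_iff)

text \<open>The inverse is there so that \<open>d = b * y\<close> cancels the coefficient of
  \<open>d ^ (2 ^ h + 1)\<close>. Since \<open>inverse 0 = 0\<close>, the map fixes 0 and can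
  permute the whole field.\<close>

definition gold_param :: "'a \<Rightarrow> 'a" where
  "gold_param b = inverse b ^ (2 ^ h + 1)"

lemma bij_gold_param: "bij gold_param"
proof -
  have "bij (inverse :: 'a \<Rightarrow> 'a)"
    by (rule involuntory_imp_bij) simp
  from bij_comp[OF this bij_gold_power] show ?thesis
    by (simp add: gold_param_def[abs_def] comp_def)
qed

text \<open>A factor \<open>1 - add_char m z\<close> is twice the indicator that \<open>z\<close>
  has trace 1, so a product of two such factors counts each nonzero coordinate four times. In the
  expansion both single character sums vanish, and \<open>d = b * y\<close> turns the joint one into
  \<open>gold_sum b\<close>.\<close>

lemma four_weight_codeword:
  assumes "b \<noteq> 0"
  shows "4 * int (hamming_weight D (codeword (gold_param b))) = 2 ^ m + gold_sum b"
proof -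
  define x where "x = gold_param b"
  have bij: "bij (\<lambda>y. b * y)"
    by (rule bij_betw_byWitness[of _ "\<lambda>y. inverse b * y"]) (use assms in \<open>auto simp flip: mult.assoc\<close>)
  have x: "x * (b * y) ^ (2 ^ h + 1) = y ^ (2 ^ h + 1)" for y
    using assms by (simp add: x_def gold_param_def power_inverse power_mult_distrib field_simps)
  have reindex: "(\<Sum>d\<in>UNIV. f d) = (\<Sum>y\<in>UNIV. f (b * y))" for f :: "'a \<Rightarrow> int"
    using sum.reindex_bij_betw[OF bij, of f] by simp
  have "4 * int (hamming_weight D (codeword x)) =
      (\<Sum>d\<in>UNIV. 4 * of_bool (d \<in> D \<and> codeword x d \<noteq> 0))"
    by (simp add: hamming_weight_def flip: sum_distrib_left)
  also have "\<dots> = (\<Sum>d\<in>UNIV. (1 - add_char m d) * (1 - add_char m (x * d ^ (2 ^ h + 1))))"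
    by (intro sum.cong refl) (auto simp: add_char_def codeword_def trace_one_set_def)
  also have "\<dots> = (\<Sum>d\<in>UNIV. 1 - add_char m d - add_char m (x * d ^ (2 ^ h + 1))
      + add_char m (x * d ^ (2 ^ h + 1) + d))"
    by (simp add: algebra_simps add_char_add)
  also have "\<dots> = 2 ^ m - (\<Sum>d\<in>UNIV. add_char m (x * d ^ (2 ^ h + 1)))
      + (\<Sum>d\<in>UNIV. add_char m (x * d ^ (2 ^ h + 1) + d))"
    by (simp only: sum.distrib sum_subtractf sum_add_char_plain) (simp add: card_field)
  also have "\<dots> = 2 ^ m + gold_sum b"
    unfolding reindex[of "\<lambda>d. add_char m (x * d ^ (2 ^ h + 1))"]
      reindex[of "\<lambda>d. add_char m (x * d ^ (2 ^ h + 1) + d)"] x gold_sum_def sum_gold_power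
    by simp
  finally show ?thesis
    by (simp add: x_def)
qed

text \<open>The strict bound comes from \<open>n + h < m\<close>. It makes the weight positive for
  every nonzero parameter, hence the encoding injective.\<close>

lemma gold_sum_gt: "- (2 ^ m) < gold_sum b"
proof -
  obtain n where n: "m = 2 * n + h" "0 < n"
    by (rule half_exponent)
  have "(2::int) ^ (n + h) < 2 ^ m"
    using n by (intro power_strict_increasing) auto
  moreover have "- (2 ^ (n + h)) \<le> gold_sum b"
    using gold_sum_values[OF n(1), of b] by auto
  ultimately show ?thesis
    by linarith
qed

lemma codeword_eq_0_iff: "codeword x = 0 \<longleftrightarrow> x = 0"
proof
  assume *: "codeword x = 0"
  show "x = 0"
  proof (rule ccontr)
    assume "x \<noteq> 0"
    obtain b where b: "x = gold_param b"
      using bij_gold_param by (metis bij_pointE)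
    with \<open>x \<noteq> 0\<close> have "b \<noteq> 0"
      by (auto simp: gold_param_def)
    hence "2 ^ m + gold_sum b = 0"
      using four_weight_codeword[of b] * b by (simp add: hamming_weight_def)
    thus False
      using gold_sum_gt[of b] by simp
  qed
qed (simp add: codeword_0)

lemma inj_codeword: "inj codeword"
proof (rule injI)
  fix x y assume "codeword x = codeword y"
  hence "codeword (x + y) = codeword (y + y)"
    by (simp only: codeword_add)
  thus "x = y"
    by (simp add: codeword_0 codeword_eq_0_iff add_eq_0_iff_eq)
qed

lemma binary_linear_code_trace_code: "binary_linear_code D (2 ^ (m - 1)) m (trace_code m h D)"
proof -
  have "bit_fun.subspace (range codeword)"
  proof (rule bit_fun.subspaceI)
    show "0 \<in> range codeword"
      using codeword_0 by (metis rangeI)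
    show "v + w \<in> range codeword" if "v \<in> range codeword" "w \<in> range codeword" for v w
      using that by (auto simp flip: codeword_add)
    show "bit_scale a v \<in> range codeword" if "v \<in> range codeword" for a v
      using that \<open>0 \<in> range codeword\<close>
      by (cases a) (simp_all only: bit_fun.scale_zero_left bit_fun.scale_one)
  qed
  moreover have "card (range codeword) = 2 ^ m"
    using inj_codeword by (simp add: card_image card_field)
  ultimately show ?thesis
    by (auto simp: binary_linear_code_def trace_code_eq card_trace_one_set bit_fun_dim_eq
        coord_space_def codeword_def)
qed

text \<open>Injectivity turns the count of codewords into one of parameters. The case
  \<open>b = 0\<close> is split off because \<open>2 ^ m + gold_sum 0\<close> is
  \<open>2 ^ m\<close>, while the codeword there is zero.\<close>

lemma weight_count_trace_code:
  "weight_count D (trace_code m h D) w =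
    card {b. 4 * int w = (if b = 0 then 0 else 2 ^ m + gold_sum b)}"
proof -
  have inj: "inj (codeword \<circ> gold_param)"
    using inj_codeword bij_gold_param by (intro inj_compose) (auto simp: bij_def)
  have weight: "4 * int (hamming_weight D (codeword (gold_param b))) =
      (if b = 0 then 0 else 2 ^ m + gold_sum b)" for b
    using four_weight_codeword[of b]
    by (simp add: hamming_weight_def gold_param_def codeword_0)
  have "range codeword = range (codeword \<circ> gold_param)"
    by (metis bij_is_surj[OF bij_gold_param] image_comp)
  hence "{c \<in> trace_code m h D. hamming_weight D c = w} =
      (codeword \<circ> gold_param) ` {b. hamming_weight D (codeword (gold_param b)) = w}"
    by (auto simp: trace_code_eq)
  hence "weight_count D (trace_code m h D) w =
      card {b. hamming_weight D (codeword (gold_param b)) = w}"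
    unfolding weight_count_def using card_image[OF inj_on_subset[OF inj subset_UNIV]] by simp
  also have "{b. hamming_weight D (codeword (gold_param b)) = w} =
      {b. 4 * int w = (if b = 0 then 0 else 2 ^ m + gold_sum b)}"
    unfolding weight[symmetric] by auto
  finally show ?thesis .
qed

text \<open>Weights are described by additive equations for \<open>4 * w\<close>, so that no
  truncated subtraction or division enters their description.\<close>

lemma weight_distribution:
  assumes m: "m = 2 * n + h" and n: "0 < n"
  defines "W \<equiv> weight_count D (trace_code m h D)"
  shows "W 0 = 1"
    and "4 * w = 2 ^ m \<Longrightarrow> W w = 2 ^ m - 1 - 2 ^ (m - h)"
    and "4 * w + 2 ^ (n + h) = 2 ^ m \<Longrightarrow> W w = 2 ^ (2 * n - 1) - 2 ^ (n - 1)"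
    and "4 * w = 2 ^ m + 2 ^ (n + h) \<Longrightarrow> W w = 2 ^ (2 * n - 1) + 2 ^ (n - 1)"
    and "w \<noteq> 0 \<Longrightarrow> 4 * w \<noteq> 2 ^ m \<Longrightarrow> 4 * w + 2 ^ (n + h) \<noteq> 2 ^ m \<Longrightarrow>
      4 * w \<noteq> 2 ^ m + 2 ^ (n + h) \<Longrightarrow> W w = 0"
proof -
  have W: "W w = card {b. 4 * int w = (if b = 0 then 0 else 2 ^ m + gold_sum b)}" for w
    by (simp add: W_def weight_count_trace_code)
  have cast: "4 * int w = 2 ^ m + a \<longleftrightarrow> 4 * w = 2 ^ m + A" if "a = int A" for w a A
    using that by (simp flip: of_nat_eq_iff[where ?'a = int])
  have cast': "4 * int w + 2 ^ (n + h) = 2 ^ m \<longleftrightarrow> 4 * w + 2 ^ (n + h) = 2 ^ m" for w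
    by (simp flip: of_nat_eq_iff[where ?'a = int])
  have lt: "(2::int) ^ (n + h) < 2 ^ m"
    using m n by (intro power_strict_increasing) auto
  have gt: "0 < 2 ^ m + gold_sum b" for b
    using gold_sum_gt[of b] by simp
  have nonzero: "W w = card {b. b \<noteq> 0 \<and> gold_sum b = 4 * int w - 2 ^ m}" if "w \<noteq> 0" for w
    unfolding W using that by (intro arg_cong[of _ _ card]) auto
  \<comment> \<open>As \<open>gold_sum 0 = 0\<close>, away from weight \<open>2 ^ (m - 2)\<close>
    the condition on the value already excludes \<open>b = 0\<close>.\<close>
  have nonzero': "W w = card {b. gold_sum b = 4 * int w - 2 ^ m}"
    if "w \<noteq> 0" "4 * int w \<noteq> 2 ^ m" for w
    unfolding nonzero[OF that(1)] using that(2) by (intro arg_cong[of _ _ card]) (auto simp: gold_sum_0)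
  have "{b. 4 * int 0 = (if b = 0 then 0 else 2 ^ m + gold_sum b)} = {0}"
    using gt by (auto simp: less_le)
  thus "W 0 = 1"
    by (simp add: W)
  show "W w = 2 ^ m - 1 - 2 ^ (m - h)" if "4 * w = 2 ^ m"
  proof -
    have "4 * int w = 2 ^ m" "w \<noteq> 0"
      using that cast[of 0 0 w] by (auto intro: ccontr)
    thus ?thesis
      using nonzero[of w] card_gold_sum(3)[OF m n] by simp
  qed
  show "W w = 2 ^ (2 * n - 1) - 2 ^ (n - 1)" if "4 * w + 2 ^ (n + h) = 2 ^ m"
  proof -
    have *: "4 * int w + 2 ^ (n + h) = 2 ^ m"
      using that cast'[of w] by simp
    hence "w \<noteq> 0"
      using lt by (cases "w = 0") auto
    moreover have "4 * int w \<noteq> 2 ^ m" "4 * int w - 2 ^ m = - (2 ^ (n + h))"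
      using * zero_less_power[of "2::int" "n + h"] by linarith+
    ultimately show ?thesis
      using nonzero'[of w] card_gold_sum(2)[OF m n] by simp
  qed
  show "W w = 2 ^ (2 * n - 1) + 2 ^ (n - 1)" if "4 * w = 2 ^ m + 2 ^ (n + h)"
  proof -
    have *: "4 * int w = 2 ^ m + 2 ^ (n + h)"
      using that cast[of "2 ^ (n + h)" "2 ^ (n + h)" w] by simp
    hence "w \<noteq> 0"
      by (intro notI) (simp add: add_pos_pos less_imp_neq)
    moreover have "4 * int w \<noteq> 2 ^ m" "4 * int w - 2 ^ m = 2 ^ (n + h)"
      using * by auto
    ultimately show ?thesis
      using nonzero'[of w] card_gold_sum(1)[OF m n] by simp
  qed
  show "W w = 0" if "w \<noteq> 0" "4 * w \<noteq> 2 ^ m" "4 * w + 2 ^ (n + h) \<noteq> 2 ^ m"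
      "4 * w \<noteq> 2 ^ m + 2 ^ (n + h)"
  proof -
    have "4 * int w \<noteq> 2 ^ m" "4 * int w + 2 ^ (n + h) \<noteq> 2 ^ m" "4 * int w \<noteq> 2 ^ m + 2 ^ (n + h)"
      using that cast[of 0 0 w] cast'[of w] cast[of "2 ^ (n + h)" "2 ^ (n + h)" w] by simp_all
    hence "gold_sum b \<noteq> 4 * int w - 2 ^ m" for b
      using gold_sum_values[OF m, of b] by auto
    thus ?thesis
      using nonzero[OF that(1)] by simp
  qed
qed

end

theorem theorem2:
  fixes m h :: nat
    and D\<^sub>1 :: "'a::finite_field set"
    and C :: "('a \<Rightarrow> bit) set"
  assumes "m > 0" and "h > 0" and "h dvd m" and "h < m" and "odd (m div h)"
    and "CARD('a) = 2 ^ m"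
    and "D\<^sub>1 = trace_one_set m"
    and "C = trace_code m h D\<^sub>1"
  shows "binary_linear_code D\<^sub>1 (2 ^ (m - 1)) m C
    \<and> weight_count D\<^sub>1 C 0 = 1
    \<and> weight_count D\<^sub>1 C (2 ^ (m - 2)) = 2 ^ m - 1 - 2 ^ (m - h)
    \<and> weight_count D\<^sub>1 C (2 ^ (m - 2) - 2 ^ ((m + h - 4) div 2))
        = 2 ^ (m - h - 1) - 2 ^ ((m - h - 2) div 2)
    \<and> weight_count D\<^sub>1 C (2 ^ (m - 2) + 2 ^ ((m + h - 4) div 2))
        = 2 ^ (m - h - 1) + 2 ^ ((m - h - 2) div 2)
    \<and> (\<forall>w. w \<notin> {0, 2 ^ (m - 2), 2 ^ (m - 2) - 2 ^ ((m + h - 4) div 2),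
                  2 ^ (m - 2) + 2 ^ ((m + h - 4) div 2)} \<longrightarrow> weight_count D\<^sub>1 C w = 0)"
proof -
  interpret gold_code m "TYPE('a)" h
    using assms by unfold_locales auto
  obtain n where n: "m = 2 * n + h" "0 < n"
    by (rule half_exponent)
  \<comment> \<open>The central weight and the deviation from it: a quarter of \<open>2 ^ m\<close>
    and of \<open>2 ^ (n + h)\<close>.\<close>
  define a t :: nat where "a = 2 ^ (m - 2)" and "t = 2 ^ (n + h - 2)"
  \<comment> \<open>No subtraction truncates here, since \<open>n\<close> and \<open>h\<close> are
    positive.\<close>
  have exps: "(m + h - 4) div 2 = n + h - 2" "m - h - 1 = 2 * n - 1" "(m - h - 2) div 2 = n - 1"
    using n h_pos by auto
  have "(2::nat) ^ k = 4 * 2 ^ (k - 2)" if "2 \<le> k" for k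
    using that by (auto simp: power_add dest!: le_Suc_ex)
  hence four: "2 ^ m = 4 * a" "2 ^ (n + h) = 4 * t"
    unfolding a_def t_def using n h_pos by simp_all
  \<comment> \<open>Makes \<open>a - t\<close> a true difference in \<open>nat\<close>.\<close>
  have "t \<le> a"
    unfolding a_def t_def using n by (intro power_increasing) auto
  note W = weight_distribution[OF n]
  have "4 * a = 2 ^ m" "4 * (a - t) + 2 ^ (n + h) = 2 ^ m" "4 * (a + t) = 2 ^ m + 2 ^ (n + h)"
    unfolding four using \<open>t \<le> a\<close> by auto
  note counts = W(2)[OF this(1)] W(3)[OF this(2)] W(4)[OF this(3)]
  have rest: "weight_count D (trace_code m h D) w = 0" if "w \<notin> {0, a, a - t, a + t}" for w
  proof (rule W(5))
    show "w \<noteq> 0" "4 * w \<noteq> 2 ^ m" "4 * w + 2 ^ (n + h) \<noteq> 2 ^ m" "4 * w \<noteq> 2 ^ m + 2 ^ (n + h)"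
      unfolding four using that by auto
  qed
  show ?thesis
    unfolding assms(7,8) exps a_def[symmetric] t_def[symmetric]
    using binary_linear_code_trace_code W(1) counts rest by simp
qed

end
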